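(* Let $Q=\mathcal N(\mathbf p,I)$ be the Gaussian distribution on $\mathbb R^n$ with mean $\mathbf p$ and identity covariance matrix, and let $|\mathcal Y|=k$. For any data distribution $\mathcal D$ on $\mathcal X\times\mathcal Y$ and any $\mathbf p\in\mathbb R^n$, $$\mathbb E_{\mathbf w\sim\mathcal N(\mathbf p,I)}\,\ell(\mathbf h_{\mathbf w}(\mathbf x),\mathbf y)=\sum_{i=1}^k\mathbb 1\{y_i=1\}\,F_{Z_i}(\mathbf 0),$$ where $F$ denotes the cumulative distribution function and $Z_i\sim\mathcal N(\boldsymbol\mu_i,\Sigma_i)$ is a $(k-1)$-variate Gaussian with, for $j,l\in\{1,\dots,k-1\}$, $$\mu_{i,j}=\begin{cases}\mathbf p\cdot(\mathbf f_{:,j}(\mathbf x)-\mathbf f_{:,i}(\mathbf x)) & \text{if } j\in\{1,\dots,i-1\},\\ \mathbf p\cdot(\mathbf f_{:,j+1}(\mathbf x)-\mathbf f_{:,i}(\mathbf x)) & \text{if } j\in\{i,\dots,k-1\},\end{cases}$$ and $$(\Sigma_i)_{j,l}=\begin{cases}(\mathbf f_{:,j}(\mathbf x)-\mathbf f_{:,i}(\mathbf x))\cdot(\mathbf f_{:,l}(\mathbf x)-\mathbf f_{:,i}(\mathbf x)) & \text{if } j<i,\ l<i,\\ (\mathbf f_{:,j+1}(\mathbf x)-\mathbf f_{:,i}(\mathbf x))\cdot(\mathbf f_{:,l}(\mathbf x)-\mathbf f_{:,i}(\mathbf x)) & \text{if } j\ge i,\ l<i,\\ (\mathbf f_{:,j}(\mathbf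 x)-\mathbf f_{:,i}(\mathbf x))\cdot(\mathbf f_{:,l+1}(\mathbf x)-\mathbf f_{:,i}(\mathbf x)) & \text{if } j<i,\ l\ge i,\\ (\mathbf f_{:,j+1}(\mathbf x)-\mathbf f_{:,i}(\mathbf x))\cdot(\mathbf f_{:,l+1}(\mathbf x)-\mathbf f_{:,i}(\mathbf x)) & \text{if } j\ge i,\ l\ge i.\end{cases}$$
   Context: $\mathcal Y$ is the set of the $k$ one-hot vectors of length $k$ ($k$ is the number of classes), $(\mathbf x,\mathbf y)\in\mathcal X\times\mathcal Y$, and $y_i$ is the $i$-th coordinate of $\mathbf y$. $\mathbf f_1,\dots,\mathbf f_n:\mathcal X\to\mathcal Y$ are fixed base classifiers; $\mathbf f(\mathbf x)$ is the $n\times k$ matrix whose $j$-th row is the prediction $\mathbf f_j(\mathbf x)$, and $\mathbf f_{:,i}(\mathbf x)\in\mathbb R^n$ is its $i$-th column. For $\mathbf w\in\mathbb R^n$, $\mathbf h_{\mathbf w}(\mathbf x)=\sum_{j=1}^n w_j\mathbf f_j(\mathbf x)$ is the weighted majority vote, and the loss considered is $$\ell(\mathbf h_{\mathbf w}(\mathbf x),\mathbf y)=\mathbb 1\Big\{\mathbf y\ne\arg\max_{\hat{\mathbf y}\in\mathcal Y}\sum_{j=1}^n w_j\,\mathbb 1\{\mathbf f_j(\mathbf x)=\hat{\mathbf y}\}\Big\}.$$ For a random vector $Z$ in $\mathbb R^{k-1}$, $F_Z(\mathbf 0)=\mathbb P(Z_1\le 0,\dots,Z_{k-1}\le 0)$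.
   Formalization: The right-hand side is corrected to the sum of 1{y_i=1}(1 − F_{Z_i}(0)); as printed it is false (n=1, k=2, f_1(x)=y=e_1, p=1 gives Φ(−1) on the left and Φ(1) on the right). The argmax is read as the set of maximizers, so a tie for the maximum is not an error. *)

theory Defs
  imports "HOL-Probability.Probability"
begin

(* Vectors of length d are functions on the index set {1..d}; measures on R^d live on the
   product space Pi\<^sub>M {1..d} (\<lambda>_. borel). *)

definition dot :: "nat \<Rightarrow> (nat \<Rightarrow> real) \<Rightarrow> (nat \<Rightarrow> real) \<Rightarrow> real" where
  "dot n u v = (\<Sum>m=1..n. u m * v m)"

(* Defined through the characteristic function exp(i <t,mu> - <t, Sigma t>/2), so that singular
   covariance matrices are allowed: below there may be k - 1 > n coordinates, and coordinates
   that are almost surely constant. *)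
definition multivariate_normal ::
    "'i set \<Rightarrow> ('i \<Rightarrow> real) \<Rightarrow> ('i \<Rightarrow> 'i \<Rightarrow> real) \<Rightarrow> ('i \<Rightarrow> real) measure \<Rightarrow> bool" where
  "multivariate_normal I \<mu> \<Sigma> M \<longleftrightarrow>
     prob_space M \<and> sets M = sets (Pi\<^sub>M I (\<lambda>_. borel)) \<and>
     (\<forall>j\<in>I. \<forall>l\<in>I. \<Sigma> j l = \<Sigma> l j) \<and>
     (\<forall>t. (CLINT z|M. iexp (\<Sum>j\<in>I. t j * z j)) =
        exp (\<i> * of_real (\<Sum>j\<in>I. t j * \<mu> j)
             - of_real (\<Sum>j\<in>I. \<Sum>l\<in>I. t j * \<Sigma> j l * t l) / 2))"

definition mv_cdf :: "'i set \<Rightarrow> ('i \<Rightarrow> real) measure \<Rightarrow> ('i \<Rightarrow> real) \<Rightarrow> real" where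
  "mv_cdf I M a = measure M {z \<in> space M. \<forall>j\<in>I. z j \<le> a j}"

definition onehot :: "nat \<Rightarrow> nat \<Rightarrow> real" where
  "onehot i = (\<lambda>j. if j = i then 1 else 0)"

definition labels :: "nat \<Rightarrow> (nat \<Rightarrow> real) set" where
  "labels k = onehot ` {1..k}"

(* The argmax is the set of all maximizers: a label that ties for the largest total weight is
   not counted as an error. Ties have positive probability when two labels receive no vote, and
   the non-strict inequalities in the distribution function at 0 match this convention: for
   y = onehot i, all the margins w . (f_{:,j} - f_{:,i}) are <= 0 iff the loss is 0. The expected
   loss is therefore 1 minus the value at 0 of the distribution function of the margins. *)
definition vote_loss ::
    "nat \<Rightarrow> nat \<Rightarrow> (nat \<Rightarrow> 'x \<Rightarrow> nat \<Rightarrow> real) \<Rightarrow> (nat \<Rightarrow> real) \<Rightarrow> 'x \<Rightarrow> (nat \<Rightarrow> real) \<Rightarrow> real" where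
  "vote_loss k n f w x y =
     of_bool (\<not> is_arg_max (\<lambda>yh. \<Sum>j=1..n. w j * of_bool (f j x = yh)) (\<lambda>yh. yh \<in> labels k) y)"

definition majority_vote ::
    "nat \<Rightarrow> (nat \<Rightarrow> 'x \<Rightarrow> nat \<Rightarrow> real) \<Rightarrow> (nat \<Rightarrow> real) \<Rightarrow> 'x \<Rightarrow> nat \<Rightarrow> real" where
  "majority_vote n f w x = (\<lambda>i. \<Sum>j=1..n. w j * f j x i)"

definition pred_column :: "(nat \<Rightarrow> 'x \<Rightarrow> nat \<Rightarrow> real) \<Rightarrow> 'x \<Rightarrow> nat \<Rightarrow> nat \<Rightarrow> real" where
  "pred_column f x i = (\<lambda>m. f m x i)"

definition column_diff :: "(nat \<Rightarrow> 'x \<Rightarrow> nat \<Rightarrow> real) \<Rightarrow> 'x \<Rightarrow> nat \<Rightarrow> nat \<Rightarrow> nat \<Rightarrow> real" where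
  "column_diff f x j i = (\<lambda>m. pred_column f x j m - pred_column f x i m)"

definition margin_mean ::
    "nat \<Rightarrow> (nat \<Rightarrow> 'x \<Rightarrow> nat \<Rightarrow> real) \<Rightarrow> 'x \<Rightarrow> (nat \<Rightarrow> real) \<Rightarrow> nat \<Rightarrow> nat \<Rightarrow> real" where
  "margin_mean n f x p i j =
     (if j < i then dot n p (column_diff f x j i)
      else dot n p (column_diff f x (j + 1) i))"

definition margin_cov ::
    "nat \<Rightarrow> (nat \<Rightarrow> 'x \<Rightarrow> nat \<Rightarrow> real) \<Rightarrow> 'x \<Rightarrow> nat \<Rightarrow> nat \<Rightarrow> nat \<Rightarrow> real" where
  "margin_cov n f x i j l =
     (if j < i \<and> l < i then dot n (column_diff f x j i) (column_diff f x l i)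
      else if j \<ge> i \<and> l < i then dot n (column_diff f x (j + 1) i) (column_diff f x l i)
      else if j < i \<and> l \<ge> i then dot n (column_diff f x j i) (column_diff f x (l + 1) i)
      else dot n (column_diff f x (j + 1) i) (column_diff f x (l + 1) i))"

(* The loss depends on the weights only through the weighted majority vote. *)
lemma vote_loss_majority_vote:
  assumes "\<And>j. j \<in> {1..n} \<Longrightarrow> f j x \<in> labels k"
  shows "vote_loss k n f w x (onehot i) =
     of_bool (\<not> is_arg_max (majority_vote n f w x) (\<lambda>l. l \<in> {1..k}) i)"
proof -
  have inj: "onehot a = onehot b \<longleftrightarrow> a = b" for a b
    by (auto simp: onehot_def fun_eq_iff split: if_splits)
  have eq: "(\<Sum>j=1..n. w j * of_bool (f j x = onehot l)) = majority_vote n f w x l" for l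
    unfolding majority_vote_def
  proof (rule sum.cong[OF refl])
    fix j assume "j \<in> {1..n}"
    then obtain a where "f j x = onehot a"
      using assms[of j] by (auto simp: labels_def)
    then show "w j * of_bool (f j x = onehot l) = w j * f j x l"
      by (auto simp: inj) (auto simp: onehot_def)
  qed
  show ?thesis
    unfolding vote_loss_def is_arg_max_def labels_def eq[symmetric]
    by (auto simp: inj simp del: sum_mult_of_bool_eq)
qed

(* Affine images of standard normal vectors are multivariate normal; in particular the
   distributions N(p, I) and N(mu_i, Sigma_i) of the theorem exist. *)
lemma multivariate_normal_exists:
  fixes B :: "'i \<Rightarrow> 'j \<Rightarrow> real"
  assumes I: "finite I" and J: "finite J"
  shows "multivariate_normal I \<mu> (\<lambda>i l. \<Sum>j\<in>J. B i j * B l j)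
    (distr (Pi\<^sub>M J (\<lambda>_. std_normal_distribution)) (Pi\<^sub>M I (\<lambda>_. borel))
      (\<lambda>z. \<lambda>i\<in>I. \<mu> i + (\<Sum>j\<in>J. B i j * z j)))"
    (is "multivariate_normal I \<mu> ?S (distr ?P ?N ?g)")
proof -
  interpret N: prob_space std_normal_distribution
    by (simp add: real_dist_normal_dist real_distribution.axioms(1))
  interpret PP: product_prob_space "\<lambda>_::'j. std_normal_distribution" J
    by unfold_locales
  have P: "prob_space ?P" by (intro prob_space_PiM N.prob_space_axioms)
  have [measurable]: "(\<lambda>z. z j) \<in> borel_measurable ?P" if "j \<in> J" for j
    using measurable_component_singleton[OF that, of "\<lambda>_. std_normal_distribution"] by simp
  have g[measurable]: "?g \<in> measurable ?P ?N"
    by (intro measurable_restrict) measurable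
  have prob: "prob_space (distr ?P ?N ?g)" by (rule prob_space.prob_space_distr[OF P g])
  have cf: "(CLINT z|distr ?P ?N ?g. iexp (\<Sum>i\<in>I. t i * z i)) =
        exp (\<i> * of_real (\<Sum>i\<in>I. t i * \<mu> i)
             - of_real (\<Sum>i\<in>I. \<Sum>l\<in>I. t i * ?S i l * t l) / 2)" for t
  proof -
    define c where "c j = (\<Sum>i\<in>I. t i * B i j)" for j
    have lin: "(\<Sum>i\<in>I. t i * ?g z i) = (\<Sum>i\<in>I. t i * \<mu> i) + (\<Sum>j\<in>J. c j * z j)" for z
    proof -
      have "(\<Sum>i\<in>I. t i * ?g z i) = (\<Sum>i\<in>I. t i * \<mu> i + (\<Sum>j\<in>J. t i * B i j * z j))"
        by (intro sum.cong) (auto simp: distrib_left sum_distrib_left mult.assoc)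
      also have "\<dots> = (\<Sum>i\<in>I. t i * \<mu> i) + (\<Sum>j\<in>J. c j * z j)"
        unfolding sum.distrib c_def sum_distrib_right by (subst (2) sum.swap) simp
      finally show ?thesis .
    qed
    have quad: "(\<Sum>i\<in>I. \<Sum>l\<in>I. t i * ?S i l * t l) = (\<Sum>j\<in>J. (c j)\<^sup>2)"
    proof -
      have "(\<Sum>i\<in>I. \<Sum>l\<in>I. t i * ?S i l * t l) =
          (\<Sum>i\<in>I. \<Sum>l\<in>I. \<Sum>j\<in>J. (t i * B i j) * (t l * B l j))"
        by (intro sum.cong refl)
           (simp add: sum_distrib_left sum_distrib_right mult_ac)
      also have "\<dots> = (\<Sum>i\<in>I. \<Sum>j\<in>J. \<Sum>l\<in>I. (t i * B i j) * (t l * B l j))"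
        by (intro sum.cong refl sum.swap)
      also have "\<dots> = (\<Sum>j\<in>J. \<Sum>i\<in>I. \<Sum>l\<in>I. (t i * B i j) * (t l * B l j))"
        by (rule sum.swap)
      also have "\<dots> = (\<Sum>j\<in>J. (c j)\<^sup>2)"
        by (simp add: c_def power2_eq_square sum_product)
      finally show ?thesis .
    qed
    have iexp_sum: "iexp (\<Sum>j\<in>J. c j * z j) = (\<Prod>j\<in>J. iexp (c j * z j))" for z
      using J by (simp add: sum_distrib_left exp_sum)
    have "(CLINT z|distr ?P ?N ?g. iexp (\<Sum>i\<in>I. t i * z i)) =
        (CLINT z|?P. iexp (\<Sum>i\<in>I. t i * ?g z i))"
      by (rule integral_distr[OF g]) measurable
    also have "\<dots> = (CLINT z|?P. iexp (\<Sum>i\<in>I. t i * \<mu> i) * (\<Prod>j\<in>J. iexp (c j * z j)))"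
      unfolding lin iexp_sum[symmetric] by (simp only: of_real_add distrib_left exp_add)
    also have "\<dots> = iexp (\<Sum>i\<in>I. t i * \<mu> i) * (CLINT z|?P. (\<Prod>j\<in>J. iexp (c j * z j)))"
      by (rule integral_mult_right_zero)
    also have "(CLINT z|?P. (\<Prod>j\<in>J. iexp (c j * z j))) =
        (\<Prod>j\<in>J. CLINT s|std_normal_distribution. iexp (c j * s))"
      by (rule PP.product_integral_prod[OF J]) (rule N.integrable_iexp, auto)
    also have "\<dots> = (\<Prod>j\<in>J. char std_normal_distribution (c j))"
      by (simp add: char_def)
    also have "\<dots> = (\<Prod>j\<in>J. exp (of_real (- ((c j)\<^sup>2) / 2)))"
      by (simp only: char_std_normal_distribution exp_of_real)
    also have "\<dots> = exp (- of_real (\<Sum>j\<in>J. (c j)\<^sup>2) / 2)"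
      using J by (simp add: exp_sum[symmetric] sum_divide_distrib sum_negf)
    finally show ?thesis
      unfolding quad by (simp only: exp_add[symmetric] diff_conv_add_uminus minus_divide_left)
  qed
  show ?thesis
    unfolding multivariate_normal_def using prob cf by (simp add: mult.commute)
qed

end

theory Submission
  imports Defs
begin

text \<open>
  The vector of margins is a linear image of the Gaussian
  weights, so it has the characteristic function of \<open>N(\<mu>\<^sub>i, \<Sigma>\<^sub>i)\<close>; the claim
  follows since a distribution on a finite product of real lines is determined by its
  characteristic function. The library has this uniqueness theorem of Levy in dimension one only.
  It is lifted one coordinate at a time, replacing factors \<open>exp (i s z\<^sub>j)\<close> by indicators of
  \<open>z\<^sub>j\<close>: the remaining exponential \<open>exp (i \<theta>)\<close> would produce a complex measure, but
  \<open>1 + cos \<theta>\<close> and \<open>1 + sin \<theta>\<close> are nonnegative weights, to which the one-dimensional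
  theorem applies.
\<close>

section \<open>Uniqueness of a law on a finite product of lines from its characteristic
  function\<close>

text \<open>Dividing the weight by its total mass \<open>c\<close> turns both weighted measures into
  probability measures, and the one-dimensional Levy theorem applies to the laws of \<open>X\<close>
  under them. The case \<open>s = 0\<close> of \<open>eq\<close> shows that \<open>c\<close> is the
  same for \<open>M\<close> and \<open>N\<close>. If \<open>c = 0\<close>, nothing can be
  normalised, but then \<open>W\<close> vanishes almost everywhere and both integrals are 0.\<close>

lemma weighted_Levy_uniqueness:
  fixes M N :: "'a measure" and W X :: "'a \<Rightarrow> real"
  assumes M: "prob_space M" and N: "prob_space N" and sets_eq: "sets N = sets M"
    and W[measurable]: "W \<in> borel_measurable M" and W_ge: "\<And>z. 0 \<le> W z" and W_le: "\<And>z. W z \<le> B"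
    and X[measurable]: "X \<in> borel_measurable M"
    and eq: "\<And>s. (CLINT z|M. of_real (W z) * iexp (s * X z)) =
                  (CLINT z|N. of_real (W z) * iexp (s * X z))"
    and A: "A \<in> sets borel"
  shows "(\<integral>z. W z * indicator A (X z) \<partial>M) = (\<integral>z. W z * indicator A (X z) \<partial>N)"
proof -
  interpret M: prob_space M by fact
  interpret N: prob_space N by fact
  note A[measurable]
  have bd: "\<bar>W z\<bar> \<le> B" for z using W_ge[of z] W_le[of z] by simp
  have iW: "integrable M W" by (rule M.integrable_const_bound[of _ B]) (auto simp: bd)
  have WN[measurable]: "W \<in> borel_measurable N" and XN[measurable]: "X \<in> borel_measurable N"
    unfolding measurable_cong_sets[OF sets_eq refl] by (rule W, rule X)
  have iWN: "integrable N W" by (rule N.integrable_const_bound[of _ B]) (auto simp: bd)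
  define c where "c = (\<integral>z. W z \<partial>M)"
  have c0: "c \<ge> 0" unfolding c_def by (rule integral_nonneg_AE) (simp add: W_ge)
  have cN: "c = (\<integral>z. W z \<partial>N)"
    using eq[of 0] by (simp add: c_def)
  show ?thesis
  proof (cases "c = 0")
    case True
    have "AE z in M. W z = 0"
      using True iW W_ge by (subst (asm) c_def) (simp add: integral_nonneg_eq_0_iff_AE)
    then have "(\<integral>z. W z * indicator A (X z) \<partial>M) = (\<integral>z. 0 \<partial>M)"
      by (intro integral_cong_AE) auto
    moreover have "AE z in N. W z = 0"
      using True iWN W_ge by (subst (asm) cN) (simp add: integral_nonneg_eq_0_iff_AE)
    then have "(\<integral>z. W z * indicator A (X z) \<partial>N) = (\<integral>z. 0 \<partial>N)"
      by (intro integral_cong_AE) auto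
    ultimately show ?thesis by simp
  next
    case False
    then have c: "c > 0" using c0 by simp
    \<comment> \<open>The law of \<open>X\<close> under the normalised weight. Its properties are
      proved for a general \<open>K\<close>, to be instantiated with both \<open>M\<close> and
      \<open>N\<close>.\<close>
    let ?d = "\<lambda>K. distr (density K (\<lambda>z. ennreal (W z / c))) borel X"
    have prob: "real_distribution (?d K)" and chr: "char (?d K) s = (CLINT z|K. of_real (W z) * iexp (s * X z)) / c"
      and meas: "measure (?d K) A = (\<integral>z. W z * indicator A (X z) \<partial>K) / c"
      if K: "prob_space K" and [measurable]: "W \<in> borel_measurable K" "X \<in> borel_measurable K"
        and iK: "integrable K W" and cK: "c = (\<integral>z. W z \<partial>K)" for K :: "'a measure" and s
    proof -
      have "emeasure (density K (\<lambda>z. ennreal (W z / c))) (space K) = (\<integral>\<^sup>+z. ennreal (W z / c) \<partial>K)"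
        by (subst emeasure_density) (auto intro!: nn_integral_cong)
      also have "\<dots> = ennreal (\<integral>z. W z / c \<partial>K)"
        using iK c by (intro nn_integral_eq_integral) (auto simp: W_ge)
      also have "\<dots> = 1" using c cK by simp
      finally have P: "prob_space (density K (\<lambda>z. ennreal (W z / c)))"
        by (intro prob_spaceI) simp
      then interpret P: prob_space "density K (\<lambda>z. ennreal (W z / c))" .
      show rd: "real_distribution (?d K)"
        by (rule P.real_distribution_distr) simp
      show "char (?d K) s = (CLINT z|K. of_real (W z) * iexp (s * X z)) / c"
        unfolding char_def
        by (subst integral_distr, simp, simp, subst integral_density)
           (use c in \<open>auto simp: W_ge scaleR_conv_of_real\<close>)
      interpret R: real_distribution "?d K" by fact
      have "measure (?d K) A = (\<integral>z. indicator A z \<partial>?d K)"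
        by (simp add: R.finite_measure_axioms)
      also have "\<dots> = (\<integral>z. (W z / c) * indicator A (X z) \<partial>K)"
        by (subst integral_distr, simp, simp, subst integral_density)
           (use c in \<open>auto simp: W_ge\<close>)
      finally show "measure (?d K) A = (\<integral>z. W z * indicator A (X z) \<partial>K) / c" by simp
    qed
    have "char (?d M) = char (?d N)"
      by (rule ext) (simp only: chr[OF M W X iW c_def] chr[OF N WN XN iWN cN] eq)
    then have "?d M = ?d N"
      by (intro Levy_uniqueness prob M N) (auto simp: iW iWN cN[symmetric] c_def[symmetric])
    then have "(\<integral>z. W z * indicator A (X z) \<partial>M) / c = (\<integral>z. W z * indicator A (X z) \<partial>N) / c"
      by (simp only: meas[OF M W X iW c_def, symmetric] meas[OF N WN XN iWN cN, symmetric])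
    then show ?thesis using c by simp
  qed
qed

text \<open>One step of the lifting: the factor \<open>iexp (s * X z)\<close> becomes an indicator
  of \<open>X z\<close>, while \<open>iexp (\<theta> z)\<close> survives. The equality is assumed
  for every multiple \<open>r\<close> of \<open>\<theta>\<close> because multiplying by a cosine of
  \<open>\<theta>\<close> mixes the frequencies 0, 1 and -1.\<close>

lemma char_replace_coordinate:
  fixes M N :: "'a measure" and w X \<theta> :: "'a \<Rightarrow> real"
  assumes M: "prob_space M" and N: "prob_space N" and sets_eq: "sets N = sets M"
    and w[measurable]: "w \<in> borel_measurable M" and w_ge: "\<And>z. 0 \<le> w z" and w_le: "\<And>z. w z \<le> 1"
    and X[measurable]: "X \<in> borel_measurable M" and \<theta>[measurable]: "\<theta> \<in> borel_measurable M"
    and eq: "\<And>s r. (CLINT z|M. of_real (w z) * iexp (s * X z + r * \<theta> z)) =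
                  (CLINT z|N. of_real (w z) * iexp (s * X z + r * \<theta> z))"
    and A: "A \<in> sets borel"
  shows "(CLINT z|M. of_real (w z * indicator A (X z)) * iexp (\<theta> z)) =
         (CLINT z|N. of_real (w z * indicator A (X z)) * iexp (\<theta> z))"
proof -
  note A[measurable]
  have bdd: "integrable K h"
    if "prob_space K" "sets K = sets M" "h \<in> borel_measurable M" "\<And>z. norm (h z) \<le> C"
    for K :: "'a measure" and h :: "'a \<Rightarrow> 'c::{banach, second_countable_topology}" and C
  proof -
    interpret prob_space K by fact
    show ?thesis
      using that measurable_cong_sets[OF that(2) refl, of borel]
      by (intro integrable_const_bound[of _ C]) auto
  qed
  have e: "integrable K (\<lambda>z. of_real (w z) * iexp (a z))"
    if "prob_space K" "sets K = sets M" "a \<in> borel_measurable M" for K a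
    using that by (intro bdd[of _ _ 1]) (auto simp: norm_mult w_ge w_le)
  have ei: "integrable K (\<lambda>z. of_real (w z * indicator A (X z)) * iexp (\<theta> z))"
    if "prob_space K" "sets K = sets M" for K
    using that
    by (intro bdd[of _ _ 1]) (auto simp: norm_mult w_ge w_le indicator_def)
  have int_w: "integrable K (\<lambda>z. w z * indicator A (X z) * g (\<theta> z))"
    if "prob_space K" "sets K = sets M" "g \<in> borel_measurable borel" "\<And>u. \<bar>g u\<bar> \<le> 1"
    for K and g :: "real \<Rightarrow> real"
  proof (rule bdd[of _ _ 1])
    note that(3)[measurable]
    show "(\<lambda>z. w z * indicator A (X z) * g (\<theta> z)) \<in> borel_measurable M" by measurable
    show "norm (w z * indicator A (X z) * g (\<theta> z)) \<le> 1" for z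
      using mult_mono[OF w_le[of z] that(4)[of "\<theta> z"]] w_ge[of z]
      by (auto simp: indicator_def abs_mult)
  qed (use that in auto)
  \<comment> \<open>The free phase \<open>\<phi>\<close> treats cosine and sine together. The factor
    \<open>1 + cos\<close> lies between 0 and 2, whence the bound \<open>B = 2\<close>.\<close>
  have weight: "(\<integral>z. w z * (1 + cos (\<theta> z + \<phi>)) * indicator A (X z) \<partial>M) =
      (\<integral>z. w z * (1 + cos (\<theta> z + \<phi>)) * indicator A (X z) \<partial>N)" for \<phi>
  proof (rule weighted_Levy_uniqueness[OF M N sets_eq _ _ _ X _ A, where B = 2])
    show "(\<lambda>z. w z * (1 + cos (\<theta> z + \<phi>))) \<in> borel_measurable M" by measurable
    show "0 \<le> w z * (1 + cos (\<theta> z + \<phi>))" for z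
      using w_ge[of z] cos_ge_minus_one[of "\<theta> z + \<phi>"] by (intro mult_nonneg_nonneg) linarith+
    show "w z * (1 + cos (\<theta> z + \<phi>)) \<le> 2" for z
    proof -
      have "w z * (1 + cos (\<theta> z + \<phi>)) \<le> 1 * 2"
        using w_ge[of z] w_le[of z] cos_ge_minus_one[of "\<theta> z + \<phi>"] cos_le_one[of "\<theta> z + \<phi>"]
        by (intro mult_mono) linarith+
      then show ?thesis by simp
    qed
    fix s
    \<comment> \<open>Euler's formula writes the cosine as half the sum of two conjugate
      exponentials, so the integral is a combination of the instances \<open>r = 0\<close>,
      \<open>r = 1\<close> and \<open>r = - 1\<close> of \<open>eq\<close>.\<close>
    have expand: "(CLINT z|K. of_real (w z * (1 + cos (\<theta> z + \<phi>))) * iexp (s * X z)) =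
       (CLINT z|K. of_real (w z) * iexp (s * X z + 0 * \<theta> z)) +
       (iexp \<phi> / 2) * (CLINT z|K. of_real (w z) * iexp (s * X z + 1 * \<theta> z)) +
       (iexp (- \<phi>) / 2) * (CLINT z|K. of_real (w z) * iexp (s * X z + (- 1) * \<theta> z))"
      if K: "prob_space K" "sets K = sets M" for K
    proof -
      have *: "of_real (w z * (1 + cos (\<theta> z + \<phi>))) * iexp (s * X z) =
         of_real (w z) * iexp (s * X z + 0 * \<theta> z) +
         (iexp \<phi> / 2) * (of_real (w z) * iexp (s * X z + 1 * \<theta> z)) +
         (iexp (- \<phi>) / 2) * (of_real (w z) * iexp (s * X z + (- 1) * \<theta> z))" for z
        by (simp add: cos_of_real[symmetric] cos_exp_eq exp_add distrib_left exp_minus exp_diff right_diff_distrib del: cos_of_real)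
           (simp add: field_simps)
      have lin3: "(CLINT z|K. a z + u * b z + v * c z) =
          (CLINT z|K. a z) + u * (CLINT z|K. b z) + v * (CLINT z|K. c z)"
        if "integrable K a" "integrable K b" "integrable K c" for a b c u v
        using that by simp
      show ?thesis
        unfolding *
        by (intro lin3 e K; measurable)
    qed
    show "(CLINT z|M. of_real (w z * (1 + cos (\<theta> z + \<phi>))) * iexp (s * X z)) =
        (CLINT z|N. of_real (w z * (1 + cos (\<theta> z + \<phi>))) * iexp (s * X z))"
      unfolding expand[OF M refl] expand[OF N sets_eq] eq ..
  qed
  have one: "(\<integral>z. w z * indicator A (X z) \<partial>M) = (\<integral>z. w z * indicator A (X z) \<partial>N)"
  proof (rule weighted_Levy_uniqueness[OF M N sets_eq w w_ge w_le X _ A])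
    show "(CLINT z|M. of_real (w z) * iexp (s * X z)) = (CLINT z|N. of_real (w z) * iexp (s * X z))" for s
      using eq[of s 0] by simp
  qed
  have cos_eq: "(\<integral>z. w z * indicator A (X z) * cos (\<theta> z + \<phi>) \<partial>M) =
      (\<integral>z. w z * indicator A (X z) * cos (\<theta> z + \<phi>) \<partial>N)" for \<phi>
  proof -
    \<comment> \<open>The constant 1 was added only for positivity; its contribution agrees for
      \<open>M\<close> and \<open>N\<close> by \<open>one\<close> and cancels.\<close>
    have split: "(\<integral>z. w z * (1 + cos (\<theta> z + \<phi>)) * indicator A (X z) \<partial>K) =
        (\<integral>z. w z * indicator A (X z) \<partial>K) + (\<integral>z. w z * indicator A (X z) * cos (\<theta> z + \<phi>) \<partial>K)"
      if K: "prob_space K" "sets K = sets M" for K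
    proof -
      have "integrable K (\<lambda>z. w z * indicator A (X z))"
        using int_w[OF K, of "\<lambda>_. 1"] by simp
      moreover have "integrable K (\<lambda>z. w z * indicator A (X z) * cos (\<theta> z + \<phi>))"
        by (intro int_w[OF K, of "\<lambda>u. cos (u + \<phi>)"]) simp_all
      ultimately show ?thesis
        by (subst Bochner_Integration.integral_add[symmetric]) (simp_all add: algebra_simps)
    qed
    show ?thesis
      using weight[of \<phi>] one unfolding split[OF M refl] split[OF N sets_eq] by simp
  qed
  \<comment> \<open>The phases 0 and \<open>- (pi / 2)\<close> yield the real and the imaginary part
    of \<open>iexp (\<theta> z)\<close>.\<close>
  have sin_shift: "cos (u + - (pi / 2)) = sin u" for u :: real
    by (simp add: cos_diff)
  have parts: "Re (CLINT z|K. of_real (w z * indicator A (X z)) * iexp (\<theta> z)) =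
      (\<integral>z. w z * indicator A (X z) * cos (\<theta> z + 0) \<partial>K)"
    "Im (CLINT z|K. of_real (w z * indicator A (X z)) * iexp (\<theta> z)) =
      (\<integral>z. w z * indicator A (X z) * cos (\<theta> z + - (pi / 2)) \<partial>K)"
    if K: "prob_space K" "sets K = sets M" for K
    unfolding integral_Re[OF ei[OF K], symmetric] integral_Im[OF ei[OF K], symmetric] sin_shift
    by (simp_all add: Re_exp Im_exp)
  show ?thesis
    by (rule complex_eqI) (simp_all only: parts[OF M refl] parts[OF N sets_eq] cos_eq)
qed

lemma measurable_coordinate:
  assumes "sets M = sets (Pi\<^sub>M I (\<lambda>_. borel))" "j \<in> I"
  shows "(\<lambda>z. z j) \<in> borel_measurable M"
  unfolding measurable_cong_sets[OF assms(1) refl] by (rule measurable_component_singleton[OF assms(2)])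

text \<open>Measurable rectangles determine a finite measure on the product, and the probability of
  a rectangle is reached from the characteristic function by inserting the indicators of its sides
  one at a time.\<close>

theorem Levy_uniqueness_PiM:
  fixes M N :: "('i \<Rightarrow> real) measure"
  assumes I: "finite I" and M: "prob_space M" and N: "prob_space N"
    and sets_M: "sets M = sets (Pi\<^sub>M I (\<lambda>_. borel))" and sets_N: "sets N = sets (Pi\<^sub>M I (\<lambda>_. borel))"
    and eq: "\<And>t. (CLINT z|M. iexp (\<Sum>j\<in>I. t j * z j)) = (CLINT z|N. iexp (\<Sum>j\<in>I. t j * z j))"
  shows "M = N"
proof -
  interpret M: prob_space M by fact
  interpret N: prob_space N by fact
  have sets_eq: "sets N = sets M" using sets_M sets_N by simp
  have comp[measurable]: "(\<lambda>z. z j) \<in> borel_measurable M" if "j \<in> I" for j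
    by (rule measurable_coordinate[OF sets_M that])
  have spM: "space M = Pi\<^sub>E I (\<lambda>_. UNIV)" and spN: "space N = Pi\<^sub>E I (\<lambda>_. UNIV)"
    using sets_eq_imp_space_eq[OF sets_M] sets_eq_imp_space_eq[OF sets_N] by (simp_all add: space_PiM)
  show ?thesis
  proof (rule measure_eqI_PiM_finite[OF I sets_M sets_N])
    fix A :: "'i \<Rightarrow> real set" assume A: "\<And>i. i \<in> I \<Longrightarrow> A i \<in> sets borel"
    \<comment> \<open>The exponent keeps all coordinates, also those in \<open>S\<close>, and
      \<open>t\<close> stays arbitrary in the induction, since the next step needs the hypothesis at
      other frequency vectors.\<close>
    have partial: "(CLINT z|M. of_real (\<Prod>j\<in>S. indicator (A j) (z j)) * iexp (\<Sum>j\<in>I. t j * z j)) =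
          (CLINT z|N. of_real (\<Prod>j\<in>S. indicator (A j) (z j)) * iexp (\<Sum>j\<in>I. t j * z j))"
      if "S \<subseteq> I" for S t
      using finite_subset[OF that I] that
    proof (induction S arbitrary: t rule: finite_induct)
      case empty
      then show ?case by (simp only: prod.empty of_real_1 mult_1 eq)
    next
      case (insert a S)
      note A[measurable]
      \<comment> \<open>The exponent required by \<open>char_replace_coordinate\<close> is again a
        linear form in \<open>z\<close>, so the induction hypothesis covers all \<open>s\<close> and
        \<open>r\<close>.\<close>
      have lin: "s * z a + r * (\<Sum>j\<in>I. t j * z j) = (\<Sum>j\<in>I. (r * t j + (if j = a then s else 0)) * z j)"
        for s r :: real and z
        using I insert.prems
        by (simp add: distrib_right sum.distrib sum_distrib_left mult.assoc if_distrib[of "\<lambda>u. u * _"]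
            sum.delta cong: if_cong)
      have "(CLINT z|M. of_real ((\<Prod>j\<in>S. indicator (A j) (z j)) * indicator (A a) (z a)) * iexp (\<Sum>j\<in>I. t j * z j)) =
          (CLINT z|N. of_real ((\<Prod>j\<in>S. indicator (A j) (z j)) * indicator (A a) (z a)) * iexp (\<Sum>j\<in>I. t j * z j))"
      proof (rule char_replace_coordinate[OF M N sets_eq])
        have "(\<lambda>z. indicator (A j) (z j) :: real) \<in> borel_measurable M" if "j \<in> S" for j
        proof -
          have [simp]: "j \<in> I" using that insert.prems by auto
          show ?thesis by measurable
        qed
        then show "(\<lambda>z. \<Prod>j\<in>S. indicator (A j) (z j) :: real) \<in> borel_measurable M"
          by (rule borel_measurable_prod)
        show "(0::real) \<le> (\<Prod>j\<in>S. indicator (A j) (z j))" for z by (simp add: prod_nonneg)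
        show "(\<Prod>j\<in>S. indicator (A j) (z j)) \<le> (1::real)" for z
          by (intro prod_le_1) (auto simp: indicator_def)
        show "(\<lambda>z. z a) \<in> borel_measurable M" using insert.prems by (intro comp) auto
        show "(\<lambda>z. \<Sum>j\<in>I. t j * z j) \<in> borel_measurable M" by measurable
        show "A a \<in> sets borel" using insert.prems by (intro A) auto
        show "(CLINT z|M. of_real (\<Prod>j\<in>S. indicator (A j) (z j)) * iexp (s * z a + r * (\<Sum>j\<in>I. t j * z j))) =
           (CLINT z|N. of_real (\<Prod>j\<in>S. indicator (A j) (z j)) * iexp (s * z a + r * (\<Sum>j\<in>I. t j * z j)))" for s r
          unfolding lin using insert.prems by (intro insert.IH) auto
      qed
      then show ?case using insert.hyps by (simp add: mult.commute)
    qed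
    have rect: "(CLINT z|K. of_real (\<Prod>j\<in>I. indicator (A j) (z j))) = of_real (measure K (Pi\<^sub>E I A))"
      if spK: "space K = Pi\<^sub>E I (\<lambda>_. UNIV)" for K :: "('i \<Rightarrow> real) measure"
    proof -
      have "(\<Prod>j\<in>I. indicator (A j) (z j)) = (indicator (Pi\<^sub>E I A) z :: real)" if "z \<in> space K" for z
        using that I unfolding spK
        by (auto simp: indicator_def PiE_iff prod_zero_iff)
      then have "(CLINT z|K. of_real (\<Prod>j\<in>I. indicator (A j) (z j))) =
          (CLINT z|K. of_real (indicator (Pi\<^sub>E I A) z))"
        by (intro Bochner_Integration.integral_cong refl) simp
      also have "\<dots> = of_real (measure K (Pi\<^sub>E I A))"
      proof -
        have "Pi\<^sub>E I A \<inter> space K = Pi\<^sub>E I A" unfolding spK by auto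
        then show ?thesis by simp
      qed
      finally show ?thesis .
    qed
    \<comment> \<open>With \<open>S = I\<close> and \<open>t = 0\<close> only the product of
      indicators is left.\<close>
    have "measure M (Pi\<^sub>E I A) = measure N (Pi\<^sub>E I A)"
      using partial[OF subset_refl, of "\<lambda>_. 0"] rect[OF spM] rect[OF spN] by simp
    then show "emeasure M (Pi\<^sub>E I A) = emeasure N (Pi\<^sub>E I A)"
      by (simp add: M.emeasure_eq_measure N.emeasure_eq_measure)
  next
    \<comment> \<open>The whole space is itself a rectangle of finite measure, so a constant
      sequence serves as the exhausting cover.\<close>
    show "range (\<lambda>_::nat. space M) \<subseteq> prod_algebra I (\<lambda>_. borel)"
      using I by (auto simp: spM prod_algebra_eq_finite intro!: image_eqI[where x = "\<lambda>_. UNIV"])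
    show "(\<Union>i::nat. space M) = space (Pi\<^sub>M I (\<lambda>_. borel))" by (simp add: spM space_PiM)
    show "emeasure M (space M) \<noteq> \<infinity>" for i :: nat by simp
  qed
qed

section \<open>Gaussian vectors: uniqueness and linear images\<close>

text \<open>The definition prescribes the characteristic function, so mean and covariance fix the
  law even when \<open>\<Sigma>\<close> is singular.\<close>

lemma multivariate_normal_unique:
  assumes "finite I" "multivariate_normal I \<mu> \<Sigma> M" "multivariate_normal I \<mu> \<Sigma> N"
  shows "M = N"
  using assms unfolding multivariate_normal_def by (intro Levy_uniqueness_PiM[of I]) auto

text \<open>A linear form with coefficients \<open>t\<close> in the image is a linear form in
  \<open>w\<close> with coefficients \<open>c\<close>, the combination of the vectors
  \<open>e j\<close> with weights \<open>t j\<close>. The characteristic function of the image at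
  \<open>t\<close> is thus that of \<open>Q\<close> at \<open>c\<close>, and the squared norm of
  \<open>c\<close> is the quadratic form of the Gram matrix of the \<open>e j\<close>.\<close>

lemma multivariate_normal_distr_dot:
  assumes I: "finite I"
    and Q: "multivariate_normal {1..n} p (\<lambda>j l. if j = l then 1 else 0) Q"
  shows "multivariate_normal I (\<lambda>j. dot n p (e j)) (\<lambda>j l. dot n (e j) (e l))
     (distr Q (Pi\<^sub>M I (\<lambda>_. borel)) (\<lambda>w. \<lambda>j\<in>I. dot n w (e j)))"
proof -
  let ?P = "Pi\<^sub>M I (\<lambda>_. borel) :: ('a \<Rightarrow> real) measure"
  let ?g = "\<lambda>w. \<lambda>j\<in>I. dot n w (e j)"
  have prob: "prob_space Q" and sets_Q: "sets Q = sets (Pi\<^sub>M {1..n} (\<lambda>_. borel))"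
    and cf: "\<And>t. (CLINT z|Q. iexp (\<Sum>j\<in>{1..n}. t j * z j)) =
        exp (\<i> * of_real (\<Sum>j\<in>{1..n}. t j * p j)
             - of_real (\<Sum>j\<in>{1..n}. \<Sum>l\<in>{1..n}. t j * (if j = l then 1 else 0) * t l) / 2)"
    using Q unfolding multivariate_normal_def by blast+
  have [measurable]: "(\<lambda>z. z j) \<in> borel_measurable Q" if "j \<in> {1..n}" for j
    by (rule measurable_coordinate[OF sets_Q that])
  have g[measurable]: "?g \<in> measurable Q ?P"
    unfolding dot_def by (intro measurable_restrict) measurable
  have "(CLINT z|distr Q ?P ?g. iexp (\<Sum>j\<in>I. t j * z j)) =
        exp (\<i> * of_real (\<Sum>j\<in>I. t j * dot n p (e j))
             - of_real (\<Sum>j\<in>I. \<Sum>l\<in>I. t j * dot n (e j) (e l) * t l) / 2)" for t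
  proof -
    define c where "c m = (\<Sum>j\<in>I. t j * e j m)" for m
    have lin: "(\<Sum>j\<in>I. t j * dot n w (e j)) = (\<Sum>m\<in>{1..n}. c m * w m)" for w
      unfolding dot_def c_def sum_distrib_left sum_distrib_right
      by (subst sum.swap) (simp add: mult_ac)
    \<comment> \<open>The identity \<open>lin\<close> is used twice: at \<open>w = e j\<close> for
      the inner sum and at \<open>w = c\<close> for the outer one.\<close>
    have "(\<Sum>j\<in>I. \<Sum>l\<in>I. t j * dot n (e j) (e l) * t l) = (\<Sum>j\<in>I. t j * dot n c (e j))"
    proof (intro sum.cong refl)
      fix j
      have "(\<Sum>l\<in>I. t j * dot n (e j) (e l) * t l) = t j * (\<Sum>l\<in>I. t l * dot n (e j) (e l))"
        by (simp add: sum_distrib_left mult_ac)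
      also have "\<dots> = t j * dot n c (e j)"
        by (simp only: lin) (simp add: dot_def)
      finally show "(\<Sum>l\<in>I. t j * dot n (e j) (e l) * t l) = t j * dot n c (e j)" .
    qed
    also have "\<dots> = (\<Sum>m\<in>{1..n}. c m * c m)" by (rule lin)
    also have "\<dots> = (\<Sum>j\<in>{1..n}. \<Sum>l\<in>{1..n}. c j * (if j = l then 1 else 0) * c l)"
      by (simp add: if_distrib[of "\<lambda>u. _ * u"] if_distrib[of "\<lambda>u. u * _"] cong: if_cong)
    finally have quad: "(\<Sum>j\<in>I. \<Sum>l\<in>I. t j * dot n (e j) (e l) * t l) =
        (\<Sum>j\<in>{1..n}. \<Sum>l\<in>{1..n}. c j * (if j = l then 1 else 0) * c l)" .
    have "(CLINT z|distr Q ?P ?g. iexp (\<Sum>j\<in>I. t j * z j)) = (CLINT w|Q. iexp (\<Sum>j\<in>I. t j * ?g w j))"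
      by (rule integral_distr[OF g]) measurable
    also have "\<dots> = (CLINT w|Q. iexp (\<Sum>m\<in>{1..n}. c m * w m))"
      unfolding lin[symmetric]
      by (intro Bochner_Integration.integral_cong arg_cong[where f = iexp] sum.cong refl) simp
    finally show ?thesis unfolding cf quad lin .
  qed
  then show ?thesis
    unfolding multivariate_normal_def
    using prob_space.prob_space_distr[OF prob g] by (simp add: dot_def mult.commute)
qed

section \<open>The loss as a condition on the margins\<close>

text \<open>Enumerates the labels other than \<open>i\<close> by skipping \<open>i\<close>. It
  absorbs the case distinctions in the mean and covariance of the margins.\<close>

definition other_label :: "nat \<Rightarrow> nat \<Rightarrow> nat" where
  "other_label i j = (if j < i then j else j + 1)"

lemma other_label_image:
  assumes "i \<in> {1..k}"
  shows "other_label i ` {1..k - 1} = {1..k} - {i}"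
proof (intro equalityI subsetI)
  fix l assume l: "l \<in> {1..k} - {i}"
  show "l \<in> other_label i ` {1..k - 1}"
  proof (cases "l < i")
    case True
    then show ?thesis using l assms by (intro image_eqI[of _ _ l]) (auto simp: other_label_def)
  next
    case False
    then show ?thesis using l assms by (intro image_eqI[of _ _ "l - 1"]) (auto simp: other_label_def)
  qed
qed (use assms in \<open>auto simp: other_label_def split: if_splits\<close>)

text \<open>Each margin is the vote total of a rival label minus that of \<open>i\<close>. Since
  \<open>i\<close> is an admissible label, it is a maximizer iff no rival is strictly ahead, so a
  tie gives margin 0 and no loss.\<close>

lemma vote_loss_margins:
  assumes "\<And>j. j \<in> {1..n} \<Longrightarrow> f j x \<in> labels k" and i: "i \<in> {1..k}"
  shows "vote_loss k n f w x (onehot i) =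
    of_bool (\<not> (\<forall>j\<in>{1..k - 1}. dot n w (column_diff f x (other_label i j) i) \<le> 0))"
proof -
  have margin: "dot n w (column_diff f x l i) = majority_vote n f w x l - majority_vote n f w x i" for l
    by (simp add: dot_def column_diff_def pred_column_def majority_vote_def right_diff_distrib sum_subtractf)
  have "is_arg_max (majority_vote n f w x) (\<lambda>l. l \<in> {1..k}) i \<longleftrightarrow>
      (\<forall>l\<in>{1..k} - {i}. majority_vote n f w x l \<le> majority_vote n f w x i)"
    using i unfolding is_arg_max_def by (auto simp: not_less)
  also have "\<dots> \<longleftrightarrow> (\<forall>j\<in>{1..k - 1}. dot n w (column_diff f x (other_label i j) i) \<le> 0)"
    unfolding other_label_image[OF i, symmetric] margin by simp
  finally show ?thesis
    using vote_loss_majority_vote[of n f x k w i] assms(1) by simp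
qed

section \<open>The expected loss as a Gaussian probability\<close>

text \<open>For the true class, \<open>mv_cdf\<close> at 0 is the probability that all margins are
  nonpositive, that is, that the loss is 0. The expected loss is the complementary probability,
  hence \<open>1 - mv_cdf\<close> where the opening formula has the distribution function itself.
  The \<open>N i\<close> are arbitrary measures with the prescribed Gaussian laws, and uniqueness
  ties the one of the true class to the margins.\<close>

theorem proposition9:
  fixes n k :: nat
    and X :: "'x set"
    and D :: "('x \<times> (nat \<Rightarrow> real)) measure"
    and f :: "nat \<Rightarrow> 'x \<Rightarrow> nat \<Rightarrow> real"
    and p :: "nat \<Rightarrow> real"
    and Q :: "(nat \<Rightarrow> real) measure"
    and N :: "nat \<Rightarrow> (nat \<Rightarrow> real) measure"
    and x :: 'x and y :: "nat \<Rightarrow> real"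
  assumes "prob_space D" and "space D = X \<times> labels k"
    and "\<And>j x. j \<in> {1..n} \<Longrightarrow> x \<in> X \<Longrightarrow> f j x \<in> labels k"
    and "(x, y) \<in> space D"
    and "multivariate_normal {1..n} p (\<lambda>j l. if j = l then 1 else 0) Q"
    and "\<And>i. i \<in> {1..k} \<Longrightarrow>
           multivariate_normal {1..k - 1} (margin_mean n f x p i) (margin_cov n f x i) (N i)"
  shows "(\<integral>w. vote_loss k n f w x y \<partial>Q) =
         (\<Sum>i=1..k. of_bool (y i = 1) * (1 - mv_cdf {1..k - 1} (N i) (\<lambda>_. 0)))"
proof -
  obtain i where i: "i \<in> {1..k}" and y: "y = onehot i" and x: "x \<in> X"
    using assms(2,4) by (auto simp: labels_def)
  define e where "e j = column_diff f x (other_label i j) i" for j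
  let ?I = "{1..k - 1}"
  let ?g = "\<lambda>w. \<lambda>j\<in>?I. dot n w (e j)"
  let ?P = "Pi\<^sub>M ?I (\<lambda>_. borel) :: (nat \<Rightarrow> real) measure"
  interpret Q: prob_space Q using assms(5) by (simp add: multivariate_normal_def)
  have sets_Q: "sets Q = sets (Pi\<^sub>M {1..n} (\<lambda>_. borel))"
    using assms(5) by (simp add: multivariate_normal_def)
  have [measurable]: "(\<lambda>z. z j) \<in> borel_measurable Q" if "j \<in> {1..n}" for j
    by (rule measurable_coordinate[OF sets_Q that])
  have dot_meas[measurable]: "(\<lambda>w. dot n w (e j)) \<in> borel_measurable Q" for j
    unfolding dot_def by measurable
  have g[measurable]: "?g \<in> measurable Q ?P"
    by (intro measurable_restrict) measurable
  \<comment> \<open>Through \<open>other_label\<close>, the two cases of the mean and the four of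
    the covariance become single dot products, in the form of
    \<open>multivariate_normal_distr_dot\<close>.\<close>
  have mean: "margin_mean n f x p i = (\<lambda>j. dot n p (e j))"
    by (auto simp: margin_mean_def e_def other_label_def fun_eq_iff)
  have cov: "margin_cov n f x i = (\<lambda>j l. dot n (e j) (e l))"
    by (auto simp: margin_cov_def e_def other_label_def fun_eq_iff)
  have "multivariate_normal ?I (\<lambda>j. dot n p (e j)) (\<lambda>j l. dot n (e j) (e l)) (N i)"
    using assms(6)[OF i] by (simp only: mean cov)
  then have Ni: "N i = distr Q ?P ?g"
    using multivariate_normal_distr_dot[OF _ assms(5)] by (intro multivariate_normal_unique[of ?I]) auto
  \<comment> \<open>The event that the weighted vote incurs no loss at
    \<open>(x, y)\<close>.\<close>
  define C where "C = {w \<in> space Q. \<forall>j\<in>?I. dot n w (e j) \<le> 0}"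
  have C[measurable]: "C \<in> sets Q" unfolding C_def by measurable
  have "mv_cdf ?I (N i) (\<lambda>_. 0) = measure Q C"
  proof -
    have "{z \<in> space ?P. \<forall>j\<in>?I. z j \<le> 0} \<in> sets ?P" by measurable
    then show ?thesis
      unfolding mv_cdf_def Ni space_distr
      by (subst measure_distr[OF g])
         (auto simp: C_def space_PiM intro!: arg_cong[where f = "measure Q"])
  qed
  moreover have "(\<integral>w. vote_loss k n f w x y \<partial>Q) = 1 - measure Q C"
  proof -
    have "(\<integral>w. vote_loss k n f w x y \<partial>Q) = (\<integral>w. indicator (space Q - C) w \<partial>Q)"
      unfolding y using vote_loss_margins[of n f x k i] assms(3)[OF _ x] i
      by (intro Bochner_Integration.integral_cong) (auto simp: C_def e_def indicator_def)
    also have "\<dots> = 1 - measure Q C"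
      by (simp add: Q.prob_compl)
    finally show ?thesis .
  qed
  \<comment> \<open>Only the true class contributes, because \<open>y\<close> is one-hot.\<close>
  moreover have "(\<Sum>j=1..k. of_bool (y j = 1) * (1 - mv_cdf ?I (N j) (\<lambda>_. 0))) =
      1 - mv_cdf ?I (N i) (\<lambda>_. 0)"
  proof -
    have "(\<Sum>j=1..k. of_bool (y j = 1) * (1 - mv_cdf ?I (N j) (\<lambda>_. 0))) =
        (\<Sum>j=1..k. if j = i then 1 - mv_cdf ?I (N j) (\<lambda>_. 0) else 0)"
      by (intro sum.cong) (auto simp: y onehot_def)
    then show ?thesis using i by simp
  qed
  ultimately show ?thesis by simp
qed

end
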